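(* Let $\{X(t)\}_{t\in\mathbb{R}^+}$ be a (possibly time-inhomogeneous) continuous-time Markov chain on the finite state space $\{1,\dots,N\}$ with transition matrices $\mathbf{T}(t_1,t_2)$, $0\le t_1\le t_2$, and suppose that the uniform distribution $\boldsymbol{\pi}=(\tfrac1N,\dots,\tfrac1N)^{\intercal}$ is stationary for the chain, i.e. $\boldsymbol{\pi}^{\intercal}\mathbf{T}(t_1,t_2)=\boldsymbol{\pi}^{\intercal}$ for all $0\le t_1\le t_2$. Then for every initial distribution of $X(0)$ and all $0\le t_1\le t_2$, $$H(X(t_2)\mid X(0))\ \ge\ H(X(t_1)\mid X(0)).$$
   Context: The transition matrices $\mathbf{T}(t_1,t_2)$ are row-stochastic, with $T_{i,j}(t_1,t_2)$ the probability of being in state $j$ at time $t_2$ given state $i$ at time $t_1$; they satisfy $\mathbf{T}(s,s)=\mathbf{I}$ and $\mathbf{T}(t_1,t_3)=\mathbf{T}(t_1,t_2)\mathbf{T}(t_2,t_3)$ for $t_1\le t_2\le t_3$. If $\mathbf{p}(t)$ is the vector of probabilities of the law of $X(t)$, then $\mathbf{p}^{\intercal}(t_2)=\mathbf{p}^{\intercal}(t_1)\mathbf{T}(t_1,t_2)$. Here $\mathbb{R}^+=[0,\infty)$. The $i$-th row entropy is $H_i(t\mid 0)=-\sum_{j}T_{i,j}(0,t)\log T_{i,j}(0,t)$, and the conditional entropy of the chain is $$H(X(t)\mid X(0))=\sum_i p_i(0)\,H_i(t\mid 0),$$ where $p_i(0)$ is the probability that $X(0)=i$. Logarithms are natural and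 $0\log 0=0$. *)

theory Defs
  imports "HOL-Probability.Probability"
begin

definition row_stochastic :: "real ^ 'n ^ 'n \<Rightarrow> bool" where
  "row_stochastic A \<longleftrightarrow> (\<forall>i j. 0 \<le> A $ i $ j) \<and> (\<forall>i. (\<Sum>j\<in>UNIV. A $ i $ j) = 1)"

(* The state space {1..N} is a finite type 'n with N = CARD('n), and time is the set of
   nonnegative reals, so T s t is constrained only for 0 <= s <= t. In the Markov property,
   F is a finite set of observation times up to t1 and x gives the states observed at those
   times; F = {} says that T t1 t2 $ i $ j is the probability of j at time t2 given i at time t1. *)
locale markov_chain = prob_space M
  for M :: "'a measure" +
  fixes X :: "real \<Rightarrow> 'a \<Rightarrow> 'n::finite"
    and T :: "real \<Rightarrow> real \<Rightarrow> real ^ 'n ^ 'n"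
  assumes random_variable_X: "0 \<le> t \<Longrightarrow> X t \<in> measurable M (count_space UNIV)"
    and row_stochastic_T: "0 \<le> s \<Longrightarrow> s \<le> t \<Longrightarrow> row_stochastic (T s t)"
    and T_refl: "0 \<le> s \<Longrightarrow> T s s = mat 1"
    and chapman_kolmogorov:
      "0 \<le> t1 \<Longrightarrow> t1 \<le> t2 \<Longrightarrow> t2 \<le> t3 \<Longrightarrow> T t1 t3 = T t1 t2 ** T t2 t3"
    and markov:
      "0 \<le> t1 \<Longrightarrow> t1 \<le> t2 \<Longrightarrow> finite F \<Longrightarrow> F \<subseteq> {0..t1} \<Longrightarrow>
       \<P>(\<omega> in M. X t1 \<omega> = i \<and> (\<forall>s\<in>F. X s \<omega> = x s)) > 0 \<Longrightarrow>
       \<P>(\<omega> in M. X t2 \<omega> = j \<bar> X t1 \<omega> = i \<and> (\<forall>s\<in>F. X s \<omega> = x s)) = T t1 t2 $ i $ j"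

definition uniform_dist :: "real ^ 'n" where
  "uniform_dist = (\<chi> i. 1 / real CARD('n))"

definition stationary :: "real ^ 'n \<Rightarrow> (real \<Rightarrow> real \<Rightarrow> real ^ 'n ^ 'n) \<Rightarrow> bool" where
  "stationary p T \<longleftrightarrow> (\<forall>t1 t2. 0 \<le> t1 \<longrightarrow> t1 \<le> t2 \<longrightarrow> p v* T t1 t2 = p)"

(* The convention 0 log 0 = 0 holds since the factor 0 annihilates the term. *)
definition row_entropy :: "(real \<Rightarrow> real \<Rightarrow> real ^ 'n ^ 'n) \<Rightarrow> 'n \<Rightarrow> real \<Rightarrow> real" where
  "row_entropy T i t = - (\<Sum>j\<in>UNIV. T 0 t $ i $ j * ln (T 0 t $ i $ j))"

(* H(X(t) | X(0)). A state i that is null at time 0 has weight 0. *)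
definition chain_cond_entropy ::
    "'a measure \<Rightarrow> (real \<Rightarrow> 'a \<Rightarrow> 'n) \<Rightarrow> (real \<Rightarrow> real \<Rightarrow> real ^ 'n ^ 'n) \<Rightarrow> real \<Rightarrow> real" where
  "chain_cond_entropy M X T t = (\<Sum>i\<in>UNIV. \<P>(\<omega> in M. X 0 \<omega> = i) * row_entropy T i t)"

end

theory Submission
  imports Defs
begin

text \<open>
  Write \<open>A = T t1 t2\<close>. By Chapman--Kolmogorov, row \<open>i\<close> of \<open>T 0 t2\<close> is \<open>r v* A\<close>, where \<open>r\<close> is
  row \<open>i\<close> of \<open>T 0 t1\<close>. Stationarity of the uniform distribution says that the columns of \<open>A\<close>
  sum to \<open>1\<close>, so \<open>A\<close> is doubly stochastic. Each entry of \<open>r v* A\<close> is then a convex combination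
  of the entries of \<open>r\<close>, and Jensen's inequality for the convex function \<open>x ln x\<close>
  (\<open>xlnx_average_le\<close>) bounds the entropy summand of that entry. Since the rows of \<open>A\<close> also sum
  to \<open>1\<close>, adding these bounds over the columns gives back the entropy of \<open>r\<close>
  (\<open>doubly_stochastic_entropy_mono\<close>). So every row entropy is nondecreasing in time, and hence so
  is any average of the row entropies with weights that do not change, in particular with the
  initial probabilities.
\<close>

text \<open>
  For \<open>x > 0\<close> this is \<open>x\<close> times the inequality \<open>ln z \<le> z - 1\<close> at \<open>z = y / x\<close>. The left-hand side is
  the tangent of \<open>x ln x\<close> at \<open>y\<close>, written as \<open>y ln y + (ln y + 1) (x - y)\<close> and simplified.
\<close>

lemma xlnx_above_tangent:
  fixes x y :: real
  assumes "0 \<le> x" and "0 < y"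
  shows "x * ln y + (x - y) \<le> x * ln x"
proof (cases "x = 0")
  case False
  with assms have x: "0 < x" by simp
  have "ln y - ln x \<le> y / x - 1"
    using ln_le_minus_one[of "y / x"] x assms by (simp add: ln_div)
  then have "x * (ln y - ln x) \<le> x * (y / x - 1)"
    using x by (intro mult_left_mono) auto
  then show ?thesis using x by (simp add: algebra_simps)
qed (use assms in simp)

text \<open>
  Jensen's inequality for \<open>x ln x\<close> on the closed half-line. The tangent is taken at the mean \<open>m\<close>,
  where its linear part averages to zero. There is no tangent at \<open>m = 0\<close>, but then every point of
  positive weight is \<open>0\<close> and both sides vanish.
\<close>

lemma xlnx_average_le:
  fixes w x :: "'i \<Rightarrow> real"
  assumes fin: "finite I"
    and w: "\<And>i. i \<in> I \<Longrightarrow> 0 \<le> w i" and w1: "(\<Sum>i\<in>I. w i) = 1"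
    and x: "\<And>i. i \<in> I \<Longrightarrow> 0 \<le> x i"
  defines "m \<equiv> \<Sum>i\<in>I. w i * x i"
  shows "m * ln m \<le> (\<Sum>i\<in>I. w i * (x i * ln (x i)))"
proof (cases "m = 0")
  case True
  then have "\<forall>i\<in>I. w i * x i = 0"
    unfolding m_def using fin w x by (subst (asm) sum_nonneg_eq_0_iff) auto
  then have "(\<Sum>i\<in>I. w i * (x i * ln (x i))) = 0"
    by (intro sum.neutral) auto
  with True show ?thesis by simp
next
  case False
  moreover have "0 \<le> m" unfolding m_def using w x by (intro sum_nonneg) auto
  ultimately have m: "0 < m" by simp
  have "(\<Sum>i\<in>I. w i * (x i * ln m + (x i - m))) = (\<Sum>i\<in>I. w i * x i * ln m + w i * x i - w i * m)"
    by (simp add: algebra_simps)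
  also have "\<dots> = m * ln m + m - (\<Sum>i\<in>I. w i) * m"
    by (simp add: m_def sum.distrib sum_subtractf sum_distrib_right)
  finally have "m * ln m = (\<Sum>i\<in>I. w i * (x i * ln m + (x i - m)))"
    using w1 by simp
  also have "\<dots> \<le> (\<Sum>i\<in>I. w i * (x i * ln (x i)))"
    using w x m by (intro sum_mono mult_left_mono xlnx_above_tangent) auto
  finally show ?thesis .
qed

text \<open>
  The two conditions on \<open>A\<close> act separately: unit column sums make each new entry an average of the
  entries of \<open>r\<close>, and unit row sums make each entry of \<open>r\<close> count once in total.
\<close>

lemma doubly_stochastic_entropy_mono:
  fixes A :: "real ^ 'n ^ 'n" and r :: "real ^ 'n"
  assumes A: "row_stochastic A" and columns: "\<And>j. (\<Sum>i\<in>UNIV. A $ i $ j) = 1"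
    and r: "\<And>i. 0 \<le> r $ i"
  shows "- (\<Sum>i\<in>UNIV. r $ i * ln (r $ i))
    \<le> - (\<Sum>j\<in>UNIV. (r v* A) $ j * ln ((r v* A) $ j))"
proof -
  have "(\<Sum>j\<in>UNIV. (r v* A) $ j * ln ((r v* A) $ j))
      \<le> (\<Sum>j\<in>UNIV. \<Sum>i\<in>UNIV. A $ i $ j * (r $ i * ln (r $ i)))"
  proof (rule sum_mono)
    fix j
    have "(r v* A) $ j = (\<Sum>i\<in>UNIV. A $ i $ j * r $ i)"
      by (simp add: vector_matrix_mult_def mult.commute)
    then show "(r v* A) $ j * ln ((r v* A) $ j)
        \<le> (\<Sum>i\<in>UNIV. A $ i $ j * (r $ i * ln (r $ i)))"
      using xlnx_average_le[of UNIV "\<lambda>i. A $ i $ j" "\<lambda>i. r $ i"] A columns r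
      by (simp add: row_stochastic_def)
  qed
  also have "\<dots> = (\<Sum>i\<in>UNIV. (\<Sum>j\<in>UNIV. A $ i $ j) * (r $ i * ln (r $ i)))"
    by (subst sum.swap) (simp add: sum_distrib_right)
  also have "\<dots> = (\<Sum>i\<in>UNIV. r $ i * ln (r $ i))"
    using A by (simp add: row_stochastic_def)
  finally show ?thesis by simp
qed

lemma uniform_invariant_column_sum:
  fixes A :: "real ^ 'n ^ 'n"
  assumes "uniform_dist v* A = uniform_dist"
  shows "(\<Sum>i\<in>UNIV. A $ i $ j) = 1"
proof -
  have "(uniform_dist v* A) $ j = (uniform_dist :: real ^ 'n) $ j"
    using assms by simp
  then have "(\<Sum>i\<in>UNIV. A $ i $ j) / real CARD('n) = 1 / real CARD('n)"
    by (simp add: vector_matrix_mult_def uniform_dist_def sum_divide_distrib)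
  then show ?thesis by simp
qed

theorem theorem3p2:
  fixes M :: "'a measure"
    and X :: "real \<Rightarrow> 'a \<Rightarrow> 'n::finite"
    and T :: "real \<Rightarrow> real \<Rightarrow> real ^ 'n ^ 'n"
    and t1 t2 :: real
  assumes "markov_chain M X T"
    and "stationary uniform_dist T"
    and "0 \<le> t1" and "t1 \<le> t2"
  shows "chain_cond_entropy M X T t2 \<ge> chain_cond_entropy M X T t1"
proof -
  interpret markov_chain M X T by fact
  have columns: "(\<Sum>i\<in>UNIV. T t1 t2 $ i $ j) = 1" for j
    using assms(2-4) by (intro uniform_invariant_column_sum) (simp add: stationary_def)
  have "row_entropy T i t1 \<le> row_entropy T i t2" for i
  proof -
    have "T 0 t2 = T 0 t1 ** T t1 t2"
      using assms(3,4) by (intro chapman_kolmogorov) auto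
    then have row: "T 0 t2 $ i = T 0 t1 $ i v* T t1 t2"
      by (simp add: vec_eq_iff matrix_matrix_mult_def vector_matrix_mult_def)
    have "0 \<le> T 0 t1 $ i $ j" for j
      using row_stochastic_T[of 0 t1] assms(3) by (simp add: row_stochastic_def)
    then show ?thesis
      unfolding row_entropy_def row
      using row_stochastic_T[OF assms(3,4)] columns
      by (intro doubly_stochastic_entropy_mono)
  qed
  then show ?thesis
    unfolding chain_cond_entropy_def by (intro sum_mono mult_left_mono) auto
qed

end
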